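(* Let $\mathcal{A}\in\mathbb{R}^{n\times n\times n_3}$ have t-eigenvalues $\lambda_i$, $i=1,2,\dots,nn_3$. Then $$\sum_{i=1}^{nn_3}|\lambda_i|^2\le n_3\|\mathcal{A}\|_F^2.$$
   Context: For a real or complex $n_1\times n_2\times n_3$ tensor $\mathcal{A}$ with frontal slices $A^{(1)},\dots,A^{(n_3)}$ (each $n_1\times n_2$), $\mathrm{bcirc}(\mathcal{A})$ is the $n_1n_3\times n_2n_3$ block circulant matrix whose first block column is $A^{(1)},A^{(2)},\dots,A^{(n_3)}$ (top to bottom), i.e. its $(i,j)$ block is $A^{(((i-j)\bmod n_3)+1)}$. $\mathrm{unfold}(\mathcal{A})$ is the first block column of $\mathrm{bcirc}(\mathcal{A})$ and $\mathrm{fold}$ is its inverse. The t-product is $\mathcal{A}*\mathcal{B}=\mathrm{fold}(\mathrm{bcirc}(\mathcal{A})\cdot\mathrm{unfold}(\mathcal{B}))$. A scalar $\lambda\in\mathbb{C}$ is a t-eigenvalue of an $n\times n\times n_3$ tensor $\mathcal{A}$ if $\mathcal{A}*\mathcal{X}=\lambda\mathcal{X}$ for some nonzero $\mathcal{X}\in\mathbb{C}^{n\times1\times n_3}$; equivalently, the t-eigenvalues are the $nn_3$ eigenvalues of $\mathrm{bcirc}(\mathcal{A})$, and they are counted with algebraic multiplicity as such. The Frobenius norm is $\|\mathcal{A}\|_F=\sqrt{\sum_{i,j,k}|a_{ijk}|^2}$. *)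

theory Defs
  imports "Jordan_Normal_Form.Char_Poly"
begin

(* A third-order tensor is the list of its frontal slices; with 0-based indexing, the slice
   A^(k+1) is A ! k, and the entry a_{i+1,j+1,k+1} is A ! k $$ (i, j). *)
type_synonym 'a tensor = "'a mat list"

definition carrier_tensor :: "nat \<Rightarrow> nat \<Rightarrow> nat \<Rightarrow> 'a tensor set" where
  "carrier_tensor n\<^sub>1 n\<^sub>2 n\<^sub>3 = {A. length A = n\<^sub>3 \<and> set A \<subseteq> carrier_mat n\<^sub>1 n\<^sub>2}"

definition tensor_rows :: "'a tensor \<Rightarrow> nat" where
  "tensor_rows A = dim_row (hd A)"

definition tensor_cols :: "'a tensor \<Rightarrow> nat" where
  "tensor_cols A = dim_col (hd A)"

definition zero_tensor :: "nat \<Rightarrow> nat \<Rightarrow> nat \<Rightarrow> 'a :: zero tensor" where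
  "zero_tensor n\<^sub>1 n\<^sub>2 n\<^sub>3 = replicate n\<^sub>3 (0\<^sub>m n\<^sub>1 n\<^sub>2)"

definition smult_tensor :: "'a :: times \<Rightarrow> 'a tensor \<Rightarrow> 'a tensor" where
  "smult_tensor c A = map (\<lambda>M. c \<cdot>\<^sub>m M) A"

definition complex_tensor :: "real tensor \<Rightarrow> complex tensor" where
  "complex_tensor A = map (map_mat complex_of_real) A"

(* Scalar row r of bcirc lies in block row r div n1, at position r mod n1 inside that block, and
   similarly for columns.  Since nat subtraction truncates, the block difference i - j modulo n3
   is written (i + n3 - j) mod n3, where j < n3. *)
definition bcirc :: "'a tensor \<Rightarrow> 'a mat" where
  "bcirc A = (let n\<^sub>1 = tensor_rows A; n\<^sub>2 = tensor_cols A; n\<^sub>3 = length A in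
     mat (n\<^sub>1 * n\<^sub>3) (n\<^sub>2 * n\<^sub>3) (\<lambda>(r, c).
       A ! ((r div n\<^sub>1 + n\<^sub>3 - c div n\<^sub>2) mod n\<^sub>3) $$ (r mod n\<^sub>1, c mod n\<^sub>2)))"

definition unfold_tensor :: "'a tensor \<Rightarrow> 'a mat" where
  "unfold_tensor A = (let n\<^sub>1 = tensor_rows A in
     mat (n\<^sub>1 * length A) (tensor_cols A) (\<lambda>(r, c). A ! (r div n\<^sub>1) $$ (r mod n\<^sub>1, c)))"

(* fold_tensor n1 n3 cuts a matrix with n1 * n3 rows into n3 slices with n1 rows each; the number
   of rows per slice cannot be recovered from the matrix alone. *)
definition fold_tensor :: "nat \<Rightarrow> nat \<Rightarrow> 'a mat \<Rightarrow> 'a tensor" where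
  "fold_tensor n\<^sub>1 n\<^sub>3 M =
     map (\<lambda>k. mat n\<^sub>1 (dim_col M) (\<lambda>(i, j). M $$ (k * n\<^sub>1 + i, j))) [0..<n\<^sub>3]"

definition t_prod :: "'a :: semiring_0 tensor \<Rightarrow> 'a tensor \<Rightarrow> 'a tensor" where
  "t_prod A B = fold_tensor (tensor_rows A) (length A) (bcirc A * unfold_tensor B)"

definition t_eigenvalue :: "complex tensor \<Rightarrow> complex \<Rightarrow> bool" where
  "t_eigenvalue A \<mu> \<longleftrightarrow>
     (\<exists>X \<in> carrier_tensor (tensor_rows A) 1 (length A).
        X \<noteq> zero_tensor (tensor_rows A) 1 (length A) \<and> t_prod A X = smult_tensor \<mu> X)"

definition t_multiplicity :: "complex tensor \<Rightarrow> complex \<Rightarrow> nat" where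
  "t_multiplicity A \<mu> = Polynomial.order \<mu> (char_poly (bcirc A))"

(* The family (l i), i in I, lists the t-eigenvalues, each as often as its algebraic
   multiplicity says. *)
definition lists_t_eigenvalues :: "complex tensor \<Rightarrow> nat set \<Rightarrow> (nat \<Rightarrow> complex) \<Rightarrow> bool" where
  "lists_t_eigenvalues A I l \<longleftrightarrow>
     (\<forall>i \<in> I. t_eigenvalue A (l i)) \<and>
     (\<forall>\<mu>. t_eigenvalue A \<mu> \<longrightarrow> card {i \<in> I. l i = \<mu>} = t_multiplicity A \<mu>)"

definition frobenius_norm :: "'a :: real_normed_vector tensor \<Rightarrow> real" where
  "frobenius_norm A =
     sqrt (\<Sum>k<length A. \<Sum>i<tensor_rows A. \<Sum>j<tensor_cols A. (norm (A ! k $$ (i, j)))\<^sup>2)"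

lemma tensor_dims:
  assumes "A \<in> carrier_tensor n\<^sub>1 n\<^sub>2 n\<^sub>3" "n\<^sub>3 > 0"
  shows "tensor_rows A = n\<^sub>1" "tensor_cols A = n\<^sub>2" "length A = n\<^sub>3"
proof -
  from assms have l: "length A = n\<^sub>3" and s: "set A \<subseteq> carrier_mat n\<^sub>1 n\<^sub>2"
    by (auto simp: carrier_tensor_def)
  with assms(2) have "hd A \<in> set A" by (intro hd_in_set) auto
  with s have "hd A \<in> carrier_mat n\<^sub>1 n\<^sub>2" by auto
  then show "tensor_rows A = n\<^sub>1" "tensor_cols A = n\<^sub>2"
    by (auto simp: tensor_rows_def tensor_cols_def)
  show "length A = n\<^sub>3" by (rule l)
qed

lemma block_index_less:
  assumes "(k::nat) < n\<^sub>3" "i < n\<^sub>1"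
  shows "k * n\<^sub>1 + i < n\<^sub>1 * n\<^sub>3"
proof -
  have "k * n\<^sub>1 + i < Suc k * n\<^sub>1" using assms by simp
  also have "\<dots> \<le> n\<^sub>3 * n\<^sub>1" using assms by (intro mult_le_mono1) simp
  finally show ?thesis by (simp add: mult.commute)
qed

lemma fold_unfold_tensor:
  assumes "A \<in> carrier_tensor n\<^sub>1 n\<^sub>2 n\<^sub>3" "n\<^sub>3 > 0"
  shows "fold_tensor n\<^sub>1 n\<^sub>3 (unfold_tensor A) = A"
proof (rule nth_equalityI)
  note d = tensor_dims[OF assms]
  show "length (fold_tensor n\<^sub>1 n\<^sub>3 (unfold_tensor A)) = length A"
    by (simp add: fold_tensor_def d)
  fix k assume "k < length (fold_tensor n\<^sub>1 n\<^sub>3 (unfold_tensor A))"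
  then have k: "k < n\<^sub>3" by (simp add: fold_tensor_def)
  then have "A ! k \<in> carrier_mat n\<^sub>1 n\<^sub>2"
    using assms d by (auto simp: carrier_tensor_def)
  then show "fold_tensor n\<^sub>1 n\<^sub>3 (unfold_tensor A) ! k = A ! k"
    using k block_index_less[OF k] by (intro eq_matI) (auto simp: fold_tensor_def unfold_tensor_def Let_def d)
qed

lemma unfold_fold_tensor:
  assumes "M \<in> carrier_mat (n\<^sub>1 * n\<^sub>3) n\<^sub>2" "n\<^sub>3 > 0"
  shows "fold_tensor n\<^sub>1 n\<^sub>3 M \<in> carrier_tensor n\<^sub>1 n\<^sub>2 n\<^sub>3"
    "unfold_tensor (fold_tensor n\<^sub>1 n\<^sub>3 M) = M"
proof -
  show c: "fold_tensor n\<^sub>1 n\<^sub>3 M \<in> carrier_tensor n\<^sub>1 n\<^sub>2 n\<^sub>3"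
    using assms by (auto simp: fold_tensor_def carrier_tensor_def)
  note d = tensor_dims[OF c assms(2)]
  show "unfold_tensor (fold_tensor n\<^sub>1 n\<^sub>3 M) = M"
  proof (rule eq_matI)
    fix r c assume "r < dim_row M" "c < dim_col M"
    then have r: "r < n\<^sub>1 * n\<^sub>3" and c: "c < n\<^sub>2" using assms by auto
    then have "n\<^sub>1 > 0" by (cases n\<^sub>1) auto
    moreover have "r div n\<^sub>1 < n\<^sub>3" using r by (simp add: less_mult_imp_div_less mult.commute)
    ultimately show "unfold_tensor (fold_tensor n\<^sub>1 n\<^sub>3 M) $$ (r, c) = M $$ (r, c)"
      using r c assms by (simp add: unfold_tensor_def Let_def d) (simp add: fold_tensor_def)
  qed (use assms d in \<open>auto simp: unfold_tensor_def Let_def\<close>)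
qed

lemma unfold_tensor_bcirc:
  assumes "A \<in> carrier_tensor n\<^sub>1 n\<^sub>2 n\<^sub>3" "n\<^sub>3 > 0"
  shows "unfold_tensor A = mat (n\<^sub>1 * n\<^sub>3) n\<^sub>2 (\<lambda>(r, c). bcirc A $$ (r, c))"
proof (rule eq_matI)
  note d = tensor_dims[OF assms]
  fix r c assume "r < dim_row (mat (n\<^sub>1 * n\<^sub>3) n\<^sub>2 (\<lambda>(r, c). bcirc A $$ (r, c)))"
    "c < dim_col (mat (n\<^sub>1 * n\<^sub>3) n\<^sub>2 (\<lambda>(r, c). bcirc A $$ (r, c)))"
  then have r: "r < n\<^sub>1 * n\<^sub>3" and c: "c < n\<^sub>2" by auto
  have "c < n\<^sub>2 * n\<^sub>3" using c assms(2) by (cases n\<^sub>3) auto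
  moreover have "r div n\<^sub>1 < n\<^sub>3" using r by (simp add: less_mult_imp_div_less mult.commute)
  ultimately show "unfold_tensor A $$ (r, c)
      = mat (n\<^sub>1 * n\<^sub>3) n\<^sub>2 (\<lambda>(r, c). bcirc A $$ (r, c)) $$ (r, c)"
    using r c by (simp add: unfold_tensor_def bcirc_def Let_def d)
qed (use tensor_dims[OF assms] in \<open>auto simp: unfold_tensor_def Let_def\<close>)

lemma unfold_smult_tensor:
  assumes "A \<in> carrier_tensor n\<^sub>1 n\<^sub>2 n\<^sub>3" "n\<^sub>3 > 0"
  shows "smult_tensor c A \<in> carrier_tensor n\<^sub>1 n\<^sub>2 n\<^sub>3"
    "unfold_tensor (smult_tensor c A) = c \<cdot>\<^sub>m unfold_tensor A"
proof -
  show s: "smult_tensor c A \<in> carrier_tensor n\<^sub>1 n\<^sub>2 n\<^sub>3"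
    using assms by (auto simp: smult_tensor_def carrier_tensor_def)
  note d = tensor_dims[OF assms] and e = tensor_dims[OF s assms(2)]
  show "unfold_tensor (smult_tensor c A) = c \<cdot>\<^sub>m unfold_tensor A"
  proof (rule eq_matI)
    fix r k assume "r < dim_row (c \<cdot>\<^sub>m unfold_tensor A)" "k < dim_col (c \<cdot>\<^sub>m unfold_tensor A)"
    then have r: "r < n\<^sub>1 * n\<^sub>3" and k: "k < n\<^sub>2" by (auto simp: unfold_tensor_def Let_def d)
    have p: "n\<^sub>1 > 0" using r by (cases n\<^sub>1) auto
    have q: "r div n\<^sub>1 < n\<^sub>3" using r by (simp add: less_mult_imp_div_less mult.commute)
    have "A ! (r div n\<^sub>1) \<in> carrier_mat n\<^sub>1 n\<^sub>2" using q assms d by (auto simp: carrier_tensor_def)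
    then show "unfold_tensor (smult_tensor c A) $$ (r, k) = (c \<cdot>\<^sub>m unfold_tensor A) $$ (r, k)"
      using r k p q by (simp add: unfold_tensor_def Let_def d e) (simp add: smult_tensor_def d)
  qed (auto simp: unfold_tensor_def Let_def d e)
qed

(* This is why t_multiplicity is read off the characteristic polynomial of bcirc. *)
lemma t_eigenvalue_iff_eigenvalue_bcirc:
  assumes A: "A \<in> carrier_tensor n n n\<^sub>3" and n3: "n\<^sub>3 > 0"
  shows "t_eigenvalue A \<mu> \<longleftrightarrow> eigenvalue (bcirc A) \<mu>"
proof -
  note d = tensor_dims[OF A n3]
  let ?N = "n * n\<^sub>3"
  have B: "bcirc A \<in> carrier_mat ?N ?N" by (simp add: bcirc_def Let_def d)
  have z: "zero_tensor n 1 n\<^sub>3 \<in> carrier_tensor n 1 n\<^sub>3" by (auto simp: zero_tensor_def carrier_tensor_def)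
  have fz: "fold_tensor n n\<^sub>3 (0\<^sub>m ?N 1) = (zero_tensor n 1 n\<^sub>3 :: complex tensor)"
    using block_index_less[of _ n\<^sub>3 _ n]
    by (intro nth_equalityI) (auto simp: fold_tensor_def zero_tensor_def intro!: eq_matI)
  have uz: "unfold_tensor (zero_tensor n 1 n\<^sub>3) = (0\<^sub>m ?N 1 :: complex mat)"
    using unfold_fold_tensor(2)[of "0\<^sub>m ?N 1 :: complex mat" n n\<^sub>3 1] n3 unfolding fz by simp
  have key: "X \<noteq> zero_tensor n 1 n\<^sub>3 \<and> t_prod A X = smult_tensor \<mu> X \<longleftrightarrow>
      unfold_tensor X \<noteq> 0\<^sub>m ?N 1 \<and> bcirc A * unfold_tensor X = \<mu> \<cdot>\<^sub>m unfold_tensor X"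
    if X: "X \<in> carrier_tensor n 1 n\<^sub>3" for X
  proof -
    have U: "unfold_tensor X \<in> carrier_mat ?N 1"
      using tensor_dims[OF X n3] by (simp add: unfold_tensor_def Let_def)
    have P: "bcirc A * unfold_tensor X \<in> carrier_mat ?N 1" using B U by simp
    have "X = zero_tensor n 1 n\<^sub>3 \<longleftrightarrow> unfold_tensor X = 0\<^sub>m ?N 1"
      using uz fz fold_unfold_tensor[OF X n3] by metis
    moreover have "t_prod A X = smult_tensor \<mu> X \<longleftrightarrow>
        bcirc A * unfold_tensor X = \<mu> \<cdot>\<^sub>m unfold_tensor X"
      unfolding t_prod_def d
      using unfold_fold_tensor(2)[OF P n3] unfold_smult_tensor[OF X n3, of \<mu>]
        fold_unfold_tensor[OF unfold_smult_tensor(1)[OF X n3, of \<mu>] n3] by metis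
    ultimately show ?thesis by simp
  qed
  show ?thesis
  proof
    assume "t_eigenvalue A \<mu>"
    then obtain X where X: "X \<in> carrier_tensor n 1 n\<^sub>3"
      and h: "unfold_tensor X \<noteq> 0\<^sub>m ?N 1" "bcirc A * unfold_tensor X = \<mu> \<cdot>\<^sub>m unfold_tensor X"
      using key by (auto simp: t_eigenvalue_def d)
    have U: "unfold_tensor X \<in> carrier_mat ?N 1"
      using tensor_dims[OF X n3] by (simp add: unfold_tensor_def Let_def)
    let ?v = "col (unfold_tensor X) 0"
    have "?v \<noteq> 0\<^sub>v ?N"
    proof
      assume v: "?v = 0\<^sub>v ?N"
      have "unfold_tensor X = 0\<^sub>m ?N 1"
      proof (rule eq_matI)
        fix r c assume "r < dim_row (0\<^sub>m ?N 1 :: complex mat)" "c < dim_col (0\<^sub>m ?N 1 :: complex mat)"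
        then have "r < ?N" "c = 0" by auto
        then show "unfold_tensor X $$ (r, c) = 0\<^sub>m ?N 1 $$ (r, c)"
          using arg_cong[OF v, of "\<lambda>w. w $ r"] U by simp
      qed (use U in auto)
      with h show False by simp
    qed
    moreover have "bcirc A *\<^sub>v ?v = \<mu> \<cdot>\<^sub>v ?v"
    proof -
      have "bcirc A *\<^sub>v ?v = col (bcirc A * unfold_tensor X) 0" by (rule col_mult2[OF B U, symmetric]) simp
      also have "\<dots> = \<mu> \<cdot>\<^sub>v ?v" using U h by auto
      finally show ?thesis .
    qed
    ultimately show "eigenvalue (bcirc A) \<mu>"
      using B U unfolding eigenvalue_def eigenvector_def by (intro exI[of _ ?v]) (auto intro: carrier_vecI)
  next
    assume "eigenvalue (bcirc A) \<mu>"
    then obtain v where v: "v \<in> carrier_vec ?N" "v \<noteq> 0\<^sub>v ?N" "bcirc A *\<^sub>v v = \<mu> \<cdot>\<^sub>v v"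
      using B unfolding eigenvalue_def eigenvector_def by auto
    define M where "M = mat ?N 1 (\<lambda>(i, j). v $ i)"
    have M: "M \<in> carrier_mat ?N 1" by (simp add: M_def)
    have cM: "col M 0 = v" using v by (auto simp: M_def)
    have "M \<noteq> 0\<^sub>m ?N 1"
    proof
      assume "M = 0\<^sub>m ?N 1"
      then have "col M 0 = 0\<^sub>v ?N" by simp
      with cM v show False by simp
    qed
    moreover have "bcirc A * M = \<mu> \<cdot>\<^sub>m M"
    proof (rule eq_matI)
      fix r c assume "r < dim_row (\<mu> \<cdot>\<^sub>m M)" "c < dim_col (\<mu> \<cdot>\<^sub>m M)"
      then have rc: "r < ?N" "c = 0" using M by auto
      have "(bcirc A * M) $$ (r, c) = (bcirc A *\<^sub>v v) $ r" using rc B M cM by simp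
      also have "\<dots> = (\<mu> \<cdot>\<^sub>m M) $$ (r, c)" using rc v M by (simp add: M_def)
      finally show "(bcirc A * M) $$ (r, c) = (\<mu> \<cdot>\<^sub>m M) $$ (r, c)" .
    qed (use B M in auto)
    ultimately show "t_eigenvalue A \<mu>"
      unfolding t_eigenvalue_def d
      using key[OF unfold_fold_tensor(1)[OF M n3]] unfold_fold_tensor[OF M n3] by auto
  qed
qed

end

theory Submission
  imports Defs "Jordan_Normal_Form.Schur_Decomposition"
begin

text \<open>
  Counted with multiplicity, the t-eigenvalues of \<open>\<A>\<close> are the eigenvalues of the square
  complex matrix \<open>bcirc \<A>\<close> (\<open>lists_t_eigenvalues_proots\<close>). Every slice of \<open>\<A>\<close> occurs in
  each of the \<open>n\<^sub>3\<close> block rows of \<open>bcirc \<A>\<close> exactly once, so its squared Frobenius norm is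
  \<open>n\<^sub>3\<close> times that of \<open>\<A>\<close> (\<open>frob_sq_bcirc\<close>). The bound is therefore Schur's inequality
  \<open>\<Sum> \<bar>\<mu>\<bar>\<^sup>2 \<le> \<parallel>M\<parallel>\<^sup>2\<close> for the eigenvalues \<open>\<mu>\<close> of a matrix \<open>M\<close> (\<open>schur_inequality\<close>), read for
  \<open>M = bcirc \<A>\<close>.

  Schur's inequality holds because \<open>M\<close> is unitarily similar to an upper triangular matrix, whose
  diagonal carries the eigenvalues, and the Frobenius norm is invariant under unitary
  similarity. The triangular form itself never appears in the proof: conjugation by a unitary
  matrix whose first column is an eigenvector for \<open>e\<close> splits off the first row and column
  (\<open>unitary_deflation\<close>), and then \<open>\<bar>e\<bar>\<^sup>2\<close> and the norm of the remaining diagonal block are at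
  most \<open>\<parallel>M\<parallel>\<^sup>2\<close> together, so that induction on the size of \<open>M\<close> applies to that block.
\<close>

section \<open>Frobenius norm and unitary matrices\<close>

definition frob_sq :: "'a :: real_normed_vector mat \<Rightarrow> real" where
  "frob_sq M = (\<Sum>i<dim_row M. \<Sum>j<dim_col M. (norm (M $$ (i, j)))\<^sup>2)"

lemma frob_sq_nonneg: "frob_sq M \<ge> 0"
  by (simp add: frob_sq_def sum_nonneg)

lemma index_mat_adjoint:
  fixes M :: "complex mat"
  assumes "i < dim_col M" "j < dim_row M"
  shows "mat_adjoint M $$ (i, j) = cnj (M $$ (j, i))"
  using assms by (simp add: mat_adjoint_def mat_of_rows_def)

lemma dim_mat_adjoint [simp]:
  "dim_row (mat_adjoint M) = dim_col M" "dim_col (mat_adjoint M) = dim_row M"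
  by (simp_all add: mat_adjoint_def)

lemma mat_adjoint_carrier [simp]:
  "M \<in> carrier_mat m n \<Longrightarrow> mat_adjoint M \<in> carrier_mat n m"
  by (auto intro: carrier_matI)

lemma mat_adjoint_mult:
  fixes M :: "complex mat"
  assumes "M \<in> carrier_mat m n" "P \<in> carrier_mat n k"
  shows "mat_adjoint (M * P) = mat_adjoint P * mat_adjoint M"
proof (rule eq_matI)
  fix i j assume "i < dim_row (mat_adjoint P * mat_adjoint M)" "j < dim_col (mat_adjoint P * mat_adjoint M)"
  then have "i < k" "j < m" using assms by auto
  then show "mat_adjoint (M * P) $$ (i, j) = (mat_adjoint P * mat_adjoint M) $$ (i, j)"
    using assms by (simp add: index_mat_adjoint scalar_prod_def mult.commute)
qed (use assms in auto)

lemma mat_adjoint_adjoint: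
  fixes M :: "complex mat"
  shows "mat_adjoint (mat_adjoint M) = M"
  by (rule eq_matI) (simp_all add: index_mat_adjoint)

lemma frob_sq_adjoint:
  fixes M :: "complex mat"
  shows "frob_sq (mat_adjoint M) = frob_sq M"
  unfolding frob_sq_def by (subst sum.swap) (simp add: index_mat_adjoint)

lemma adjoint_mult_diag:
  fixes M :: "complex mat"
  assumes "M \<in> carrier_mat m n" "j < n"
  shows "(mat_adjoint M * M) $$ (j, j) = complex_of_real (\<Sum>i<m. (cmod (M $$ (i, j)))\<^sup>2)"
  using assms unfolding of_real_sum complex_norm_square
  by (simp add: scalar_prod_def index_mat_adjoint atLeast0LessThan mult.commute)

lemma frob_sq_adjoint_mult:
  fixes M :: "complex mat"
  assumes "M \<in> carrier_mat m n"
  shows "complex_of_real (frob_sq M) = (\<Sum>j<n. (mat_adjoint M * M) $$ (j, j))"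
proof -
  have "complex_of_real (frob_sq M) = (\<Sum>j<n. complex_of_real (\<Sum>i<m. (cmod (M $$ (i, j)))\<^sup>2))"
    using assms unfolding frob_sq_def by (subst sum.swap) simp
  also have "\<dots> = (\<Sum>j<n. (mat_adjoint M * M) $$ (j, j))"
    by (rule sum.cong) (simp_all add: adjoint_mult_diag[OF assms])
  finally show ?thesis .
qed

text \<open>
  The diagonal entries of \<open>mat_adjoint M * M\<close> are the squared lengths of the columns of \<open>M\<close>, so
  the Frobenius norm depends on this Gram matrix only, which an isometry on the left preserves.
\<close>
lemma frob_sq_isometry:
  fixes V :: "complex mat"
  assumes V: "V \<in> carrier_mat m n" and I: "mat_adjoint V * V = 1\<^sub>m n" and M: "M \<in> carrier_mat n k"
  shows "frob_sq (V * M) = frob_sq M"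
proof -
  have "mat_adjoint (V * M) * (V * M) = mat_adjoint M * mat_adjoint V * (V * M)"
    using mat_adjoint_mult[OF V M] by simp
  also have "\<dots> = mat_adjoint M * (mat_adjoint V * V * M)"
    using V M by (simp add: assoc_mult_mat[of _ k n _ m _ k] assoc_mult_mat[of _ n m _ n _ k])
  also have "\<dots> = mat_adjoint M * M"
    using M by (simp add: I)
  finally have "complex_of_real (frob_sq (V * M)) = complex_of_real (frob_sq M)"
    using V M by (simp add: frob_sq_adjoint_mult[of _ m k] frob_sq_adjoint_mult[of _ n k])
  then show ?thesis by simp
qed

text \<open>
  Taking adjoints moves the right factor \<open>U\<close> to the left, so that both factors of the conjugation
  are removed by the invariance under left isometries.
\<close>
lemma frob_sq_unitary_conjugation:
  fixes U :: "complex mat"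
  assumes U: "U \<in> carrier_mat n n" and I: "mat_adjoint U * U = 1\<^sub>m n" and M: "M \<in> carrier_mat n n"
  shows "frob_sq (mat_adjoint U * M * U) = frob_sq M"
proof -
  have I': "U * mat_adjoint U = 1\<^sub>m n"
    using mat_mult_left_right_inverse[OF _ U I] U by simp
  have "mat_adjoint (mat_adjoint U * M * U) = mat_adjoint U * (mat_adjoint M * U)"
    using U M by (simp add: mat_adjoint_mult[of _ n n _ n] mat_adjoint_adjoint mult_carrier_mat[of _ n n _ n])
  then have "frob_sq (mat_adjoint U * M * U) = frob_sq (mat_adjoint U * (mat_adjoint M * U))"
    by (metis frob_sq_adjoint)
  also have "\<dots> = frob_sq (mat_adjoint M * U)"
    using U M I' by (intro frob_sq_isometry[of _ n n _ n]) (auto simp: mat_adjoint_adjoint)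
  also have "\<dots> = frob_sq (mat_adjoint U * M)"
    using frob_sq_adjoint[of "mat_adjoint M * U"] U M
    by (simp add: mat_adjoint_mult[of _ n n _ n] mat_adjoint_adjoint)
  also have "\<dots> = frob_sq M"
    using U M I' by (intro frob_sq_isometry[of _ n n _ n]) (auto simp: mat_adjoint_adjoint)
  finally show ?thesis .
qed

section \<open>Schur's inequality\<close>

text \<open>
  Gram-Schmidt orthogonalisation keeps the first vector of a basis and yields orthogonal vectors
  that are not normalised; dividing each of them by its length gives the columns of \<open>U\<close>.
\<close>
lemma unitary_with_first_column:
  fixes v :: "complex vec"
  assumes v: "v \<in> carrier_vec n" and v0: "v \<noteq> 0\<^sub>v n"
  obtains U c where "U \<in> carrier_mat n n" "mat_adjoint U * U = 1\<^sub>m n" "col U 0 = c \<cdot>\<^sub>v v"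
proof -
  interpret cof_vec_space n "TYPE(complex)" .
  define ws where "ws = gram_schmidt n (basis_completion v)"
  note b = basis_completion[OF v v0]
  note g = gram_schmidt_result[OF b(2) b(4) b(5) ws_def]
  have len: "length ws = n" using g(4) b(6) by simp
  have wc: "ws ! i \<in> carrier_vec n" if "i < n" for i using g(3) that len by auto
  have n: "n > 0" using v v0 by (cases n) auto
  have "hd ws = v" using gram_schmidt_hd[OF v] by (simp add: ws_def basis_completion_def Let_def)
  then have w0: "ws ! 0 = v" using n len by (metis hd_conv_nth length_0_conv less_numeral_extra(3))
  define s where "s j = complex_of_real (sqrt (\<Sum>i<n. (cmod (ws ! j $ i))\<^sup>2))" for j
  have ssq: "s j * s j = ws ! j \<bullet>c ws ! j" if "j < n" for j
  proof -
    have "s j * s j = complex_of_real (\<Sum>i<n. (cmod (ws ! j $ i))\<^sup>2)"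
      unfolding s_def by (simp only: of_real_mult[symmetric]) (simp add: sum_nonneg)
    also have "\<dots> = ws ! j \<bullet>c ws ! j"
      using wc[OF that] unfolding of_real_sum complex_norm_square
      by (simp add: scalar_prod_def atLeast0LessThan)
    finally show ?thesis .
  qed
  have s0: "s j \<noteq> 0" if "j < n" for j
    using ssq[OF that] corthogonalD[OF g(2), of j j] that len by auto
  define U where "U = mat n n (\<lambda>(i, j). ws ! j $ i / s j)"
  have U: "U \<in> carrier_mat n n" by (simp add: U_def)
  have "mat_adjoint U * U = 1\<^sub>m n"
  proof (rule eq_matI)
    fix i j assume "i < dim_row (1\<^sub>m n :: complex mat)" "j < dim_col (1\<^sub>m n :: complex mat)"
    then have i: "i < n" and j: "j < n" by auto
    have "(mat_adjoint U * U) $$ (i, j) = (\<Sum>k<n. ws ! j $ k * cnj (ws ! i $ k)) / (s i * s j)"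
      using i j U by (simp add: scalar_prod_def index_mat_adjoint atLeast0LessThan U_def sum_divide_distrib
          s_def mult.commute)
    also have "(\<Sum>k<n. ws ! j $ k * cnj (ws ! i $ k)) = ws ! j \<bullet>c ws ! i"
      using wc[OF i] wc[OF j] by (simp add: scalar_prod_def atLeast0LessThan)
    also have "\<dots> / (s i * s j) = 1\<^sub>m n $$ (i, j)"
      using i j s0[OF j] ssq[OF j] corthogonalD[OF g(2), of j i] len
      by (cases "i = j") (auto simp flip: ssq)
    finally show "(mat_adjoint U * U) $$ (i, j) = 1\<^sub>m n $$ (i, j)" .
  qed (use U in auto)
  moreover have "col U 0 = (1 / s 0) \<cdot>\<^sub>v v"
    using n v by (intro eq_vecI) (auto simp: U_def w0)
  ultimately show thesis using U that by blast
qed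

text \<open>
  If the first column \<open>u\<close> of \<open>U\<close> is an eigenvector for \<open>e\<close>, then the first column of the conjugated
  matrix is \<open>mat_adjoint U *\<^sub>v (M *\<^sub>v u) = e \<cdot>\<^sub>v (mat_adjoint U *\<^sub>v u)\<close>, a multiple of the first unit vector.
\<close>
lemma unitary_deflation:
  fixes M :: "complex mat"
  assumes M: "M \<in> carrier_mat (Suc m) (Suc m)"
  obtains e B C U where "B \<in> carrier_mat 1 m" "C \<in> carrier_mat m m"
    "U \<in> carrier_mat (Suc m) (Suc m)" "mat_adjoint U * U = 1\<^sub>m (Suc m)"
    "mat_adjoint U * M * U = four_block_mat (mat 1 1 (\<lambda>_. e)) B (0\<^sub>m m 1) C"
proof -
  let ?n = "Suc m"
  have "\<exists>e. poly (char_poly M) e = 0"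
    using degree_monic_char_poly[OF M]
    by (intro fundamental_theorem_of_algebra) (auto simp: constant_degree)
  then obtain e where "eigenvalue M e" using eigenvalue_root_char_poly[OF M] by blast
  then obtain v where v: "v \<in> carrier_vec ?n" "v \<noteq> 0\<^sub>v ?n" "M *\<^sub>v v = e \<cdot>\<^sub>v v"
    using M unfolding eigenvalue_def eigenvector_def by auto
  obtain U c where U: "U \<in> carrier_mat ?n ?n" and I: "mat_adjoint U * U = 1\<^sub>m ?n"
    and c: "col U 0 = c \<cdot>\<^sub>v v"
    using unitary_with_first_column[OF v(1,2)] by blast
  define T where "T = mat_adjoint U * M * U"
  have T: "T \<in> carrier_mat ?n ?n" using U M by (auto simp: T_def)
  have U': "mat_adjoint U \<in> carrier_mat ?n ?n" using U by simp
  have "col T 0 = mat_adjoint U *\<^sub>v (M *\<^sub>v col U 0)"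
    unfolding T_def assoc_mult_mat[OF U' M U] col_mult2[OF U' mult_carrier_mat[OF M U] zero_less_Suc]
      col_mult2[OF M U zero_less_Suc] ..
  also have "M *\<^sub>v col U 0 = e \<cdot>\<^sub>v col U 0"
    using v M by (simp add: c mult_mat_vec smult_smult_assoc mult.commute)
  also have "mat_adjoint U *\<^sub>v (e \<cdot>\<^sub>v col U 0) = e \<cdot>\<^sub>v col (mat_adjoint U * U) 0"
    unfolding col_mult2[OF U' U zero_less_Suc]
    by (rule mult_mat_vec[OF U' col_carrier_vec[OF zero_less_Suc U]])
  finally have col: "col T 0 = e \<cdot>\<^sub>v unit_vec ?n 0" by (simp add: I)
  have T0: "T $$ (i, 0) = (if i = 0 then e else 0)" if "i < ?n" for i
    using arg_cong[OF col, of "\<lambda>w. w $ i"] that T by (auto simp: unit_vec_def)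
  define B where "B = mat 1 m (\<lambda>(i, j). T $$ (0, Suc j))"
  define C where "C = mat m m (\<lambda>(i, j). T $$ (Suc i, Suc j))"
  have "T = four_block_mat (mat 1 1 (\<lambda>_. e)) B (0\<^sub>m m 1) C"
  proof (rule eq_matI)
    let ?F = "four_block_mat (mat 1 1 (\<lambda>_. e)) B (0\<^sub>m m 1) C"
    fix i j assume "i < dim_row ?F" "j < dim_col ?F"
    then have "i < ?n" "j < ?n" by (simp_all add: C_def)
    then show "T $$ (i, j) = ?F $$ (i, j)"
      by (cases i; cases j) (simp_all add: B_def C_def T0)
  qed (use T in \<open>simp_all add: C_def\<close>)
  then show thesis
    using U I unfolding T_def by (intro that[of B C U e]) (simp_all add: B_def C_def)
qed

lemma frob_sq_deflated:
  assumes "B \<in> carrier_mat 1 m" "C \<in> carrier_mat m m"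
  shows "frob_sq (four_block_mat (mat 1 1 (\<lambda>_. e)) B (0\<^sub>m m 1) C) = (norm e)\<^sup>2 + frob_sq B + frob_sq C"
  using assms by (simp add: frob_sq_def sum.lessThan_Suc_shift del: sum.lessThan_Suc)

text \<open>
  Deflation splits the eigenvalues of \<open>M\<close> into \<open>e\<close> and those of \<open>C\<close>, and it splits the squared
  norm of \<open>M\<close> into those of \<open>e\<close>, \<open>B\<close> and \<open>C\<close>. What the inequality loses is the norm of the rows \<open>B\<close>
  over all induction steps, that is, of the part of a triangular form above the diagonal.
\<close>
theorem schur_inequality:
  fixes M :: "complex mat"
  assumes "M \<in> carrier_mat n n"
  shows "(\<Sum>\<mu>\<in>#proots (char_poly M). (cmod \<mu>)\<^sup>2) \<le> frob_sq M"
  using assms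
proof (induction n arbitrary: M)
  case 0
  then have "char_poly M = 1"
    using degree_monic_char_poly[OF 0] by (metis degree_eq_zeroE lead_coeff_pCons(2) one_pCons)
  then show ?case by (simp add: frob_sq_nonneg)
next
  case (Suc m)
  obtain e B C U where B: "B \<in> carrier_mat 1 m" and C: "C \<in> carrier_mat m m"
    and U: "U \<in> carrier_mat (Suc m) (Suc m)" and I: "mat_adjoint U * U = 1\<^sub>m (Suc m)"
    and T: "mat_adjoint U * M * U = four_block_mat (mat 1 1 (\<lambda>_. e)) B (0\<^sub>m m 1) C"
    by (rule unitary_deflation[OF Suc.prems])
  let ?T = "mat_adjoint U * M * U" and ?E = "mat 1 1 (\<lambda>_. e)"
  have I': "U * mat_adjoint U = 1\<^sub>m (Suc m)"
    using mat_mult_left_right_inverse[OF _ U I] U by simp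
  have "similar_mat ?T M"
    unfolding similar_mat_def using U I I' Suc.prems
    by (intro exI[of _ "mat_adjoint U"] exI[of _ U] similar_mat_witI[of _ _ "Suc m"]) auto
  then have "char_poly M = char_poly ?T" by (rule char_poly_similar[symmetric])
  also have "\<dots> = char_poly ?E * char_poly C"
    unfolding T by (rule char_poly_four_block_zeros_col[OF _ B C]) simp
  also have "char_poly ?E = [:- e, 1:]"
    by (simp add: char_poly_defs det_def sign_def)
  finally have cp: "char_poly M = [:- e, 1:] * char_poly C" .
  have "char_poly C \<noteq> 0" using degree_monic_char_poly[OF C] by auto
  then have "proots (char_poly M) = {#e#} + proots (char_poly C)"
    unfolding cp by (subst proots_mult) auto
  then have "(\<Sum>\<mu>\<in>#proots (char_poly M). (cmod \<mu>)\<^sup>2)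
      = (cmod e)\<^sup>2 + (\<Sum>\<mu>\<in>#proots (char_poly C). (cmod \<mu>)\<^sup>2)"
    by simp
  also have "\<dots> \<le> (cmod e)\<^sup>2 + frob_sq B + frob_sq C"
    using Suc.IH[OF C] frob_sq_nonneg[of B] by simp
  also have "\<dots> = frob_sq ?T"
    unfolding T by (rule frob_sq_deflated[OF B C, symmetric])
  also have "\<dots> = frob_sq M"
    by (rule frob_sq_unitary_conjugation[OF U I Suc.prems])
  finally show ?case .
qed

section \<open>t-Eigenvalues\<close>

lemma sum_div_mod_blocks:
  fixes f :: "nat \<Rightarrow> nat \<Rightarrow> 'a :: comm_monoid_add"
  shows "(\<Sum>r<n * m. f (r div n) (r mod n)) = (\<Sum>k<m. \<Sum>i<n. f k i)"
proof -
  have "(\<Sum>r<n * m. f (r div n) (r mod n)) = (\<Sum>k<m. \<Sum>r = k * n..<k * n + n. f (r div n) (r mod n))"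
    by (simp add: sum.nat_group mult.commute)
  also have "\<dots> = (\<Sum>k<m. \<Sum>i<n. f k i)"
  proof (rule sum.cong)
    fix k
    have "(\<Sum>r = k * n..<k * n + n. f (r div n) (r mod n))
        = (\<Sum>i = 0..<n. f ((i + k * n) div n) ((i + k * n) mod n))"
      using sum.shift_bounds_nat_ivl[of "\<lambda>r. f (r div n) (r mod n)" 0 "k * n" n]
      by (simp add: add.commute)
    also have "\<dots> = (\<Sum>i<n. f k i)"
      by (rule sum.cong) auto
    finally show "(\<Sum>r = k * n..<k * n + n. f (r div n) (r mod n)) = (\<Sum>i<n. f k i)" .
  qed simp
  finally show ?thesis .
qed

text \<open>For \<open>q < m\<close>, the map \<open>q \<mapsto> (p - q) mod m\<close> is an involution of the residues modulo \<open>m\<close>.\<close>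
lemma sum_cyclic_shift:
  fixes f :: "nat \<Rightarrow> 'a :: comm_monoid_add"
  assumes "p < m"
  shows "(\<Sum>q<m. f ((p + m - q) mod m)) = (\<Sum>k<m. f k)"
proof (rule sum.reindex_bij_witness[of _ "\<lambda>k. (p + m - k) mod m" "\<lambda>q. (p + m - q) mod m"])
  have inv: "(p + m - (p + m - q) mod m) mod m = q" if "q < m" for q
  proof (cases "q \<le> p")
    case True
    then have "(p + m - q) mod m = p - q"
      using assms by (simp flip: add_diff_assoc2)
    then show ?thesis using True that by simp
  next
    case False
    then have "(p + m - q) mod m = p + m - q" using assms that by simp
    then show ?thesis using that by simp
  qed
  then show "(p + m - (p + m - q) mod m) mod m = q" "(p + m - (p + m - q) mod m) mod m = q"
    if "q \<in> {..<m}" for q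
    using that by auto
qed (use assms in auto)

text \<open>
  In each fixed block row \<open>p\<close>, the slice index \<open>(p - q) mod n\<^sub>3\<close> of the block in column \<open>q\<close> runs through all
  slices exactly once.
\<close>
lemma frob_sq_bcirc:
  fixes A :: "'a :: real_normed_vector tensor"
  shows "frob_sq (bcirc A) = real (length A) * (frobenius_norm A)\<^sup>2"
proof -
  let ?n\<^sub>1 = "tensor_rows A" and ?n\<^sub>2 = "tensor_cols A" and ?n\<^sub>3 = "length A"
  let ?S = "\<lambda>k i j. (norm (A ! k $$ (i, j)))\<^sup>2"
  have "frob_sq (bcirc A) = (\<Sum>r<?n\<^sub>1 * ?n\<^sub>3. \<Sum>c<?n\<^sub>2 * ?n\<^sub>3.
      ?S ((r div ?n\<^sub>1 + ?n\<^sub>3 - c div ?n\<^sub>2) mod ?n\<^sub>3) (r mod ?n\<^sub>1) (c mod ?n\<^sub>2))"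
    by (simp add: frob_sq_def bcirc_def Let_def)
  also have "\<dots> = (\<Sum>p<?n\<^sub>3. \<Sum>i<?n\<^sub>1. \<Sum>q<?n\<^sub>3. \<Sum>j<?n\<^sub>2. ?S ((p + ?n\<^sub>3 - q) mod ?n\<^sub>3) i j)"
    by (simp only: sum_div_mod_blocks[of "\<lambda>q j. ?S ((_ + ?n\<^sub>3 - q) mod ?n\<^sub>3) _ j"]
        sum_div_mod_blocks[of "\<lambda>p i. \<Sum>q<?n\<^sub>3. \<Sum>j<?n\<^sub>2. ?S ((p + ?n\<^sub>3 - q) mod ?n\<^sub>3) i j"])
  also have "\<dots> = (\<Sum>p<?n\<^sub>3. \<Sum>i<?n\<^sub>1. \<Sum>k<?n\<^sub>3. \<Sum>j<?n\<^sub>2. ?S k i j)"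
    by (intro sum.cong refl sum_cyclic_shift[of _ _ "\<lambda>k. \<Sum>j<?n\<^sub>2. ?S k _ j"]) simp
  also have "\<dots> = real ?n\<^sub>3 * (\<Sum>k<?n\<^sub>3. \<Sum>i<?n\<^sub>1. \<Sum>j<?n\<^sub>2. ?S k i j)"
    by (subst sum.swap[of _ "{..<?n\<^sub>3}" "{..<?n\<^sub>1}"]) simp
  also have "\<dots> = real ?n\<^sub>3 * (frobenius_norm A)\<^sup>2"
    by (simp add: frobenius_norm_def sum_nonneg)
  finally show ?thesis .
qed

text \<open>
  Both multisets give a t-eigenvalue its algebraic multiplicity. Any other number is not a root of
  the characteristic polynomial, and no \<open>l i\<close> equals it since every \<open>l i\<close> is a t-eigenvalue.
\<close>
lemma lists_t_eigenvalues_proots: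
  assumes A: "A \<in> carrier_tensor n n n\<^sub>3" and n3: "n\<^sub>3 > 0"
    and I: "finite I" and l: "lists_t_eigenvalues A I l"
  shows "image_mset l (mset_set I) = proots (char_poly (bcirc A))"
proof (rule multiset_eqI)
  fix \<mu>
  have B: "bcirc A \<in> carrier_mat (n * n\<^sub>3) (n * n\<^sub>3)"
    by (simp add: bcirc_def Let_def tensor_dims[OF A n3])
  have "char_poly (bcirc A) \<noteq> 0" using degree_monic_char_poly[OF B] by auto
  then have "count (proots (char_poly (bcirc A))) \<mu> = t_multiplicity A \<mu>"
    by (simp add: t_multiplicity_def)
  also have "\<dots> = card {i \<in> I. l i = \<mu>}"
  proof (cases "t_eigenvalue A \<mu>")
    case True
    then show ?thesis using l by (simp add: lists_t_eigenvalues_def)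
  next
    case False
    then have "poly (char_poly (bcirc A)) \<mu> \<noteq> 0"
      using t_eigenvalue_iff_eigenvalue_bcirc[OF A n3] eigenvalue_root_char_poly[OF B] by simp
    then have "t_multiplicity A \<mu> = 0" by (simp add: t_multiplicity_def order_0I)
    moreover have empty: "{i \<in> I. l i = \<mu>} = {}"
      using False l by (auto simp: lists_t_eigenvalues_def)
    ultimately show ?thesis unfolding empty by simp
  qed
  also have "\<dots> = count (image_mset l (mset_set I)) \<mu>"
    using I by (simp add: count_image_mset' count_mset_set' eq_commute)
  finally show "count (image_mset l (mset_set I)) \<mu> = count (proots (char_poly (bcirc A))) \<mu>" ..
qed

lemma frobenius_norm_complex_tensor:
  assumes A: "A \<in> carrier_tensor n\<^sub>1 n\<^sub>2 n\<^sub>3"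
  shows "frobenius_norm (complex_tensor A) = frobenius_norm A"
proof (cases "n\<^sub>3 = 0")
  case True
  then show ?thesis using A by (simp add: frobenius_norm_def carrier_tensor_def complex_tensor_def)
next
  case False
  have cA: "complex_tensor A \<in> carrier_tensor n\<^sub>1 n\<^sub>2 n\<^sub>3"
    using A by (auto simp: carrier_tensor_def complex_tensor_def)
  have "A ! k \<in> carrier_mat n\<^sub>1 n\<^sub>2" if "k < n\<^sub>3" for k
    using A that by (auto simp: carrier_tensor_def)
  then have dims: "dim_row (A ! k) = n\<^sub>1" "dim_col (A ! k) = n\<^sub>2" if "k < n\<^sub>3" for k
    using that by auto
  have "cmod (complex_tensor A ! k $$ (i, j)) = norm (A ! k $$ (i, j))"
    if "k < n\<^sub>3" "i < n\<^sub>1" "j < n\<^sub>2" for k i j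
    using that A dims[of k] by (simp add: complex_tensor_def carrier_tensor_def)
  then show ?thesis
    using False tensor_dims[OF A] tensor_dims[OF cA] by (simp add: frobenius_norm_def)
qed

theorem sum_t_eigenvalues_le:
  assumes A: "A \<in> carrier_tensor n n n\<^sub>3" and n3: "n\<^sub>3 > 0"
    and I: "finite I" and l: "lists_t_eigenvalues A I l"
  shows "(\<Sum>i\<in>I. (cmod (l i))\<^sup>2) \<le> real n\<^sub>3 * (frobenius_norm A)\<^sup>2"
proof -
  have B: "bcirc A \<in> carrier_mat (n * n\<^sub>3) (n * n\<^sub>3)"
    by (simp add: bcirc_def Let_def tensor_dims[OF A n3])
  have "(\<Sum>i\<in>I. (cmod (l i))\<^sup>2) = (\<Sum>\<mu>\<in>#image_mset l (mset_set I). (cmod \<mu>)\<^sup>2)"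
    by (simp add: sum_unfold_sum_mset image_mset.compositionality o_def)
  also have "\<dots> \<le> frob_sq (bcirc A)"
    unfolding lists_t_eigenvalues_proots[OF assms] by (rule schur_inequality[OF B])
  also have "\<dots> = real n\<^sub>3 * (frobenius_norm A)\<^sup>2"
    by (simp add: frob_sq_bcirc tensor_dims[OF A n3])
  finally show ?thesis .
qed

theorem theorem5p1:
  fixes A :: "real tensor" and n n\<^sub>3 :: nat and l :: "nat \<Rightarrow> complex"
  assumes "A \<in> carrier_tensor n n n\<^sub>3"
    and "lists_t_eigenvalues (complex_tensor A) {1..n * n\<^sub>3} l"
  shows "(\<Sum>i = 1..n * n\<^sub>3. (cmod (l i))\<^sup>2) \<le> real n\<^sub>3 * (frobenius_norm A)\<^sup>2"
  \<comment> \<open>For \<open>n\<^sub>3 = 0\<close> both sides vanish, while the size of a slice cannot be read off the empty tensor.\<close>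
proof (cases "n\<^sub>3 = 0")
  case False
  have "complex_tensor A \<in> carrier_tensor n n n\<^sub>3"
    using assms(1) by (auto simp: carrier_tensor_def complex_tensor_def)
  from sum_t_eigenvalues_le[OF this _ _ assms(2)] False show ?thesis
    by (simp add: frobenius_norm_complex_tensor[OF assms(1)])
qed simp

end
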